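(* Consider the online energy scheduling problem and the Pattern-Aware Online Energy Scheduling algorithm described in the context, with decision sets $\mathcal{X}_0(t)\subset\mathbb{R}^3$, objective functions $f^t$, long-term constraint functions $\mathbf{g}^t=(g_1^t,g_2^t)$, and $K$ time windows $\mathcal{W}_1,\dots,\mathcal{W}_K$ partitioning $\{1,\dots,T\}$. Let $G_1,G_2,\beta$ be constants such that for all feasible decisions $\mathbf{x},\mathbf{y}$ (elements of the sets $\mathcal{X}_0(t)$) and all $t$: $\|\mathbf{x}-\mathbf{y}\|\le G_1$, $\|\mathbf{g}^t(\mathbf{x})\|\le G_2$, and $\|\mathbf{g}^t(\mathbf{x})-\mathbf{g}^t(\mathbf{y})\|\le\beta\|\mathbf{x}-\mathbf{y}\|$. Assume there exist $\epsilon>0$ and $\hat{\mathbf{x}}$ with $\hat{\mathbf{x}}\in\mathcal{X}_0(t)$ and $g_i^t(\hat{\mathbf{x}})\le-\epsilon$ for $i=1,2$ and all $t$. For each horizon $T\ge1$, run the algorithm with $$\gamma=T^{1/4},\qquad \alpha=\tfrac12(\beta^2+1)\sqrt{T}$$ (that is, $\alpha=\frac12(\gamma^2\beta^2+\eta)$ with the auxiliary analysis parameter $\eta=\sqrt T$), and let $\mathbf{x}(1),\dots,\mathbf{x}(T)$ be the decisions it produces. For each $k$ let $$\mathbf{x}^*(k)\in\arg\min_{\mathbf{x}}\sum_{t\in\mathcal{W}_k}f^t(\mathbf{x}),$$ the minimum being over fixed decisions $\mathbf{x}$ that lie in $\mathcal{X}_0(t)$ for every $t\in\mathcal{W}_k$.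 Then: 1. (Sublinear regret) For all $T\ge1$, $$\sum_{k=1}^K\sum_{t\in\mathcal{W}_k}f^t(\mathbf{x}(t))\le\sum_{k=1}^K\sum_{t\in\mathcal{W}_k}f^t(\mathbf{x}^*(k))+O(\sqrt{T}).$$ 2. (Constraint violations) For all $T\ge1$ and $i=1,2$, $$\sum_{k=1}^K\sum_{t\in\mathcal{W}_k}g_i^t(\mathbf{x}(t))\le 2KG_2+\frac{K\left(\frac12(\beta^2+1)G_1^2+G_1+2G_2^2\right)}{\epsilon}+\frac{KG_1}{\epsilon\sqrt{T}}.$$
   Context: $\|\cdot\|$ is the Euclidean norm. **Problem.** Time is slotted, $t=1,\dots,T$. In each slot $t$ the scheduler of a satellite chooses $\mathbf{x}(t)=(E_{\mathrm{out}}(t),f_{\mathrm{cmp}}(t),R(t))\in\mathbb{R}^3$ (discharged battery energy, CPU frequency, transmission rate) from the bounded convex set of decisions satisfying the instantaneous constraints of that slot, $$\mathcal{X}_0(t)=\{(E_{\mathrm{out}},f_{\mathrm{cmp}},R):\ 0\le E_{\mathrm{out}}\le\bar E,\ 0\le f_{\mathrm{cmp}}\le f_{\mathrm{cmp}}^{\max}(t),\ 0\le R\le R^{\max}I_c(t)\},$$ where $\bar E$ and $R^{\max}$ are finite constants, $f_{\mathrm{cmp}}^{\max}(t)$ is the maximal CPU frequency in slot $t$, and $I_c(t)\in\{0,1\}$ indicates whether the satellite-ground connection is available in slot $t$. The objective in slot $t$ is the discharged energy $f^t(\mathbf{x})=E_{\mathrm{out}}$, so $\|\nabla f^t(\mathbf{x})\|=1$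 for all $\mathbf{x},t$. The long-term constraint functions are the affine functions $\mathbf{g}^t=(g_1^t,g_2^t)$, $$g_1^t(\mathbf{x})=D f_{\mathrm{sen}}(t)-\kappa f_{\mathrm{cmp}},\qquad g_2^t(\mathbf{x})=\rho\kappa f_{\mathrm{cmp}}-R,$$ where $D$ is the data size of an image frame, $f_{\mathrm{sen}}(t)\ge0$ is the camera frame rate in slot $t$, $\kappa$ is the number of bits processed per CPU cycle, and $\rho\in[0,1]$ is the effective data proportion. The long-term constraints are $\sum_{t=1}^Tg_i^t(\mathbf{x}(t))\le0$, $i=1,2$. **Time windows.** Each slot $t$ has a pattern vector $\mathbf{c}(t)$ in a pattern space $\Omega=[0,1]^N$. The space $\Omega$ is partitioned into $K=L^N$ hypercubes $\Omega_1,\dots,\Omega_K$ of side $1/L$, and $\mathcal{W}_k=\{t\in\{1,\dots,T\}:\mathbf{c}(t)\in\Omega_k\}$. Thus $\mathcal{W}_1,\dots,\mathcal{W}_K$ partition $\{1,\dots,T\}$ (windows need not consist of consecutive slots). Write $t_k^1<t_k^2<\cdots$ for the elements of $\mathcal{W}_k$ in increasing order. **Algorithm (Pattern-Aware Online Energy Scheduling), with parameters $\alpha,\gamma>0$.** Put $\tilde{g}_i^t=\gamma g_i^t$. For each window $\mathcal{W}_k$ maintain virtual queues $Q_i^V$, $i=1,2$, with initial value $Q_i^V(t_k^0):=0$. - At $t=t_k^1$: choose an arbitrary $\mathbf{x}(t)\in\mathcal{X}_0(t)$. - At $t=t_k^\tau$ with $\tau\ge2$: let $s=t_k^{\tau-1}$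 and let $\mathbf{x}(t)$ be the Euclidean projection onto $\mathcal{X}_0(t)$ of the point $\mathbf{x}(s)-\frac{1}{2\alpha}\mathbf{d}(s)$, where $$\mathbf{d}(s)=\nabla f^{s}(\mathbf{x}(s))+\sum_{i=1}^2\left[Q_i^V(s)+\tilde{g}_i^s(\mathbf{x}(s))\right]\nabla\tilde{g}_i^s(\mathbf{x}(s)).$$ - After choosing $\mathbf{x}(t)$ at $t=t_k^\tau$ ($\tau\ge1$), update for $i=1,2$ $$Q_i^V(t_k^\tau)=\max\{-\tilde{g}_i^t(\mathbf{x}(t)),\ Q_i^V(t_k^{\tau-1})+\tilde{g}_i^t(\mathbf{x}(t))\}.$$ *)

theory Defs
  imports "HOL-Analysis.Analysis"
begin

(* A decision is the vector (E_out, f_cmp, R), with components x$1, x$2, x$3. *)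

definition decision_set ::
  "real \<Rightarrow> real \<Rightarrow> (nat \<Rightarrow> real) \<Rightarrow> (nat \<Rightarrow> real) \<Rightarrow> nat \<Rightarrow> (real^3) set" where
  "decision_set Ebar Rmax fmax Ic t =
     {x. 0 \<le> x$1 \<and> x$1 \<le> Ebar \<and> 0 \<le> x$2 \<and> x$2 \<le> fmax t \<and> 0 \<le> x$3 \<and> x$3 \<le> Rmax * Ic t}"

definition objective :: "nat \<Rightarrow> real^3 \<Rightarrow> real" where
  "objective t x = x$1"

definition constraint_fun ::
  "real \<Rightarrow> real \<Rightarrow> real \<Rightarrow> (nat \<Rightarrow> real) \<Rightarrow> nat \<Rightarrow> real^3 \<Rightarrow> real^2" where
  "constraint_fun D \<kappa> \<rho> fsen t x = vector [D * fsen t - \<kappa> * x$2, \<rho> * \<kappa> * x$2 - x$3]"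

(* The cells are disjoint, so each boundary point of the grid belongs to exactly one of
   the adjacent cells; which one is left open by only requiring each cell to lie between
   an open cube of side 1/L and its closure. *)
definition hypercube_partition :: "nat \<Rightarrow> (nat \<Rightarrow> (real^'n) set) \<Rightarrow> bool" where
  "hypercube_partition L \<Omega> \<longleftrightarrow>
     1 \<le> L \<and>
     disjoint_family_on \<Omega> {1..L ^ CARD('n)} \<and>
     (\<Union>k\<in>{1..L ^ CARD('n)}. \<Omega> k) = {p. \<forall>j. 0 \<le> p$j \<and> p$j \<le> 1} \<and>
     (\<forall>k\<in>{1..L ^ CARD('n)}. \<exists>a.
        box a (a + vec (1 / real L)) \<subseteq> \<Omega> k \<and> \<Omega> k \<subseteq> cbox a (a + vec (1 / real L)))"

definition window :: "nat \<Rightarrow> (nat \<Rightarrow> real^'n) \<Rightarrow> (real^'n) set \<Rightarrow> nat set" where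
  "window T c A = {t \<in> {1..T}. c t \<in> A}"

(* The \<tau>-th smallest element of the finite set W, for 1 \<le> \<tau> \<le> card W. *)
definition slot :: "nat set \<Rightarrow> nat \<Rightarrow> nat" where
  "slot W \<tau> = sorted_list_of_set W ! (\<tau> - 1)"

definition gradient :: "('a::real_inner \<Rightarrow> real) \<Rightarrow> 'a \<Rightarrow> 'a" where
  "gradient h x = (THE d. GDERIV h x :> d)"

lemma gradient_eqI:
  assumes "GDERIV h x :> d"
  shows "gradient h x = d"
  unfolding gradient_def
proof (rule the_equality)
  show "GDERIV h x :> d" by (rule assms)
next
  fix e assume "GDERIV h x :> e"
  then have "(\<lambda>v. inner v e) = (\<lambda>v. inner v d)"
    using assms unfolding gderiv_def by (rule has_derivative_unique)
  then have "inner (e - d) e = inner (e - d) d"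
    by (rule fun_cong)
  then have "inner (e - d) (e - d) = 0"
    by (simp add: inner_diff_right)
  then show "e = d"
    by simp
qed

lemma has_derivative_component: "((\<lambda>y. y $ j) has_derivative (\<lambda>h. h $ j)) F"
  by (rule bounded_linear_imp_has_derivative) (rule bounded_linear_vec_nth)

lemma gradient_objective: "gradient (objective t) x = axis 1 1"
  unfolding objective_def
  by (rule gradient_eqI)
    (auto simp: gderiv_def inner_axis
      intro!: derivative_eq_intros has_derivative_component)

lemma gradient_constraint_1:
  "gradient (\<lambda>y. \<gamma> * constraint_fun D \<kappa> \<rho> fsen t y $ 1) x = axis 2 (- (\<gamma> * \<kappa>))"
  unfolding constraint_fun_def
  by (rule gradient_eqI)
    (auto simp: gderiv_def inner_axis algebra_simps
      intro!: derivative_eq_intros has_derivative_component)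

lemma gradient_constraint_2:
  "gradient (\<lambda>y. \<gamma> * constraint_fun D \<kappa> \<rho> fsen t y $ 2) x =
     axis 2 (\<gamma> * \<rho> * \<kappa>) + axis 3 (- \<gamma>)"
  unfolding constraint_fun_def
  by (rule gradient_eqI)
    (auto simp: gderiv_def inner_axis inner_add_right algebra_simps
      intro!: derivative_eq_intros has_derivative_component)

(* The argument \<tau> of the queue is the position within the window W; position 0 carries the
   initial value, and the queue after slot (slot W \<tau>) is virtual_queue \<gamma> g W x i \<tau>. *)
primrec virtual_queue ::
  "real \<Rightarrow> (nat \<Rightarrow> 'a \<Rightarrow> real^2) \<Rightarrow> nat set \<Rightarrow> (nat \<Rightarrow> 'a) \<Rightarrow> 2 \<Rightarrow> nat \<Rightarrow> real" where
  "virtual_queue \<gamma> g W x i 0 = 0"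
| "virtual_queue \<gamma> g W x i (Suc \<tau>) =
     (let t = slot W (Suc \<tau>); v = \<gamma> * g t (x t) $ i
      in max (- v) (virtual_queue \<gamma> g W x i \<tau> + v))"

definition direction ::
  "real \<Rightarrow> (nat \<Rightarrow> 'a::real_inner \<Rightarrow> real) \<Rightarrow> (nat \<Rightarrow> 'a \<Rightarrow> real^2) \<Rightarrow> nat set \<Rightarrow>
     (nat \<Rightarrow> 'a) \<Rightarrow> nat \<Rightarrow> 'a" where
  "direction \<gamma> f g W x \<tau> =
     (let s = slot W \<tau> in
      gradient (f s) (x s) +
      (\<Sum>i\<in>UNIV. (virtual_queue \<gamma> g W x i \<tau> + \<gamma> * g s (x s) $ i) *\<^sub>R
                 gradient (\<lambda>y. \<gamma> * g s y $ i) (x s)))"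

definition window_run ::
  "real \<Rightarrow> real \<Rightarrow> (nat \<Rightarrow> ('a::euclidean_space) set) \<Rightarrow> (nat \<Rightarrow> 'a \<Rightarrow> real) \<Rightarrow>
     (nat \<Rightarrow> 'a \<Rightarrow> real^2) \<Rightarrow> nat set \<Rightarrow> (nat \<Rightarrow> 'a) \<Rightarrow> bool" where
  "window_run \<alpha> \<gamma> X f g W x \<longleftrightarrow>
     (W \<noteq> {} \<longrightarrow> x (slot W 1) \<in> X (slot W 1)) \<and>
     (\<forall>\<tau>\<in>{2..card W}.
        x (slot W \<tau>) =
          closest_point (X (slot W \<tau>))
            (x (slot W (\<tau> - 1)) - (1 / (2 * \<alpha>)) *\<^sub>R direction \<gamma> f g W x (\<tau> - 1)))"

end

theory Submission
  imports Defs
begin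

text \<open>
  Each projection step is a proximal step, so \<open>x(t)\<close> satisfies a three-point inequality against any
  feasible point.

  Regret: the objective sees only the first coordinate \<open>e\<close>, the constraints only the other two, and
  the decision sets are boxes.  Hence \<open>e\<close> evolves on its own, the three-point inequality against
  \<open>0\<close> reads \<open>e(t) \<le> \<alpha> (e(s)\<^sup>2 - e(t)\<^sup>2)\<close>, and this telescopes to \<open>O(\<alpha>)\<close>.

  Violations: a window's violation is at most its last queue length divided by \<open>\<gamma>\<close>.  As
  \<open>g\<^sup>t - g\<^sup>s\<close> does not depend on the decision, the linearised constraints of slot \<open>s\<close> can be
  replaced by those of slot \<open>t\<close> in the three-point inequality against the Slater point.  It then
  shows that the norm of the queue cannot grow once it exceeds
  \<open>\<gamma> G2 + (\<alpha> G1\<^sup>2 + G1 + 2 \<gamma>\<^sup>2 G2\<^sup>2) / (\<gamma> \<epsilon>)\<close>, and a single step increases it by at most \<open>\<gamma> G2\<close>.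
\<close>

section \<open>Projection steps and queue updates\<close>

text \<open>Obtuse-angle property of the projection, scaled by \<open>2 * \<alpha>\<close> so that
  \<open>d\<close> enters with coefficient 1: the optimality condition for minimising
  \<open>d \<bullet> u + \<alpha> * (norm (u - p))\<^sup>2\<close> over \<open>u\<close> in
  \<open>S\<close>.\<close>

lemma closest_point_step_variational:
  fixes p d y :: "'a::euclidean_space"
  assumes "convex S" "closed S" "y \<in> S" "0 < \<alpha>"
    and z: "z = closest_point S (p - (1 / (2 * \<alpha>)) *\<^sub>R d)"
  shows "d \<bullet> (z - y) + 2 * \<alpha> * ((z - p) \<bullet> (z - y)) \<le> 0"
proof -
  have "(p - (1 / (2 * \<alpha>)) *\<^sub>R d - z) \<bullet> (y - z) \<le> 0"
    unfolding z using assms by (intro closest_point_dot)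
  then have "2 * \<alpha> * ((p - (1 / (2 * \<alpha>)) *\<^sub>R d - z) \<bullet> (y - z)) \<le> 0"
    using \<open>0 < \<alpha>\<close> by (simp add: mult_le_0_iff)
  also have "2 * \<alpha> * ((p - (1 / (2 * \<alpha>)) *\<^sub>R d - z) \<bullet> (y - z))
      = d \<bullet> (z - y) + 2 * \<alpha> * ((z - p) \<bullet> (z - y))"
    using \<open>0 < \<alpha>\<close> by (simp add: inner_diff_left inner_diff_right algebra_simps)
  finally show ?thesis .
qed

lemma inner_three_point:
  fixes p z y :: "'a::real_inner"
  shows "2 * ((z - p) \<bullet> (z - y)) = (norm (y - z))\<^sup>2 + (norm (z - p))\<^sup>2 - (norm (y - p))\<^sup>2"
  by (simp add: power2_norm_eq_inner inner_diff_left inner_diff_right inner_commute algebra_simps)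

text \<open>Expanding \<open>q + a\<close> componentwise costs only one
  \<open>(norm a)\<^sup>2\<close>; the second pays for the branch \<open>- a\<close> of the
  maximum.\<close>

lemma queue_drift:
  fixes q q' a :: "real^'n"
  assumes "\<And>i. q' $ i = max (- a $ i) (q $ i + a $ i)"
  shows "(norm q')\<^sup>2 \<le> (norm q)\<^sup>2 + 2 * (q \<bullet> a) + 2 * (norm a)\<^sup>2"
proof -
  have "(q' $ i)\<^sup>2 \<le> (q $ i)\<^sup>2 + 2 * (q $ i * a $ i) + 2 * (a $ i)\<^sup>2" for i
  proof (cases "- a $ i \<le> q $ i + a $ i")
    case True
    then have "q' $ i = q $ i + a $ i" using assms by (simp add: max_def)
    then show ?thesis by (simp add: power2_sum)
  next
    case False
    then have "q' $ i = - a $ i" using assms by (simp add: max_def)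
    \<comment> \<open>The gap between the two sides is exactly
      \<open>(q $ i + a $ i)\<^sup>2\<close>.\<close>
    then show ?thesis using zero_le_power2[of "q $ i + a $ i"] by (simp add: power2_sum)
  qed
  then have "(\<Sum>i\<in>UNIV. (q' $ i)\<^sup>2)
      \<le> (\<Sum>i\<in>UNIV. (q $ i)\<^sup>2 + 2 * (q $ i * a $ i) + 2 * (a $ i)\<^sup>2)"
    by (intro sum_mono)
  then show ?thesis
    unfolding power2_norm_eq_inner inner_vec_def
    by (simp add: sum.distrib sum_distrib_left power2_eq_square)
qed

lemma queue_norm_growth:
  fixes q q' a :: "real^'n"
  assumes "\<And>i. q' $ i = max (- a $ i) (q $ i + a $ i)" "\<And>i. 0 \<le> q $ i"
  shows "norm q' \<le> norm q + norm a"
proof -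
  have "norm q' \<le> norm (q + (\<chi> i. \<bar>a $ i\<bar>))"
  proof (rule norm_le_componentwise_cart)
    fix i
    show "norm (q' $ i) \<le> norm ((q + (\<chi> i. \<bar>a $ i\<bar>)) $ i)"
      using assms(1)[of i] assms(2)[of i] by (simp add: max_def abs_if)
  qed
  also have "\<dots> \<le> norm q + norm (\<chi> i. \<bar>a $ i\<bar>)"
    by (rule norm_triangle_ineq)
  also have "norm (\<chi> i. \<bar>a $ i\<bar>) = norm a"
    by (simp add: norm_vec_def)
  finally show ?thesis .
qed

section \<open>Virtual queues along a window\<close>

lemma virtual_queue_nonneg: "0 \<le> virtual_queue \<gamma> g W x i n"
  by (induction n) (auto simp: Let_def max_def)

text \<open>The branch \<open>- v\<close> of the update serves this purpose: the weights of the
  constraint gradients in \<open>direction\<close> stay nonnegative, as the Slater argument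
  requires.\<close>

lemma virtual_queue_plus_nonneg:
  "0 \<le> virtual_queue \<gamma> g W x i (Suc n) + \<gamma> * g (slot W (Suc n)) (x (slot W (Suc n))) $ i"
  by (simp add: Let_def max_def)

text \<open>Every update adds at least \<open>v\<close>; this turns bounds on the queue into bounds
  on the violation.\<close>

lemma sum_le_virtual_queue:
  "(\<Sum>k<n. \<gamma> * g (slot W (Suc k)) (x (slot W (Suc k))) $ i) \<le> virtual_queue \<gamma> g W x i n"
  by (induction n) (auto simp: Let_def max_def)

lemma slot_mem: "finite W \<Longrightarrow> k < card W \<Longrightarrow> slot W (Suc k) \<in> W"
  using nth_mem[of k "sorted_list_of_set W"] by (simp add: slot_def)

lemma sum_slot:
  assumes "finite W"
  shows "(\<Sum>t\<in>W. h t) = (\<Sum>k<card W. h (slot W (Suc k)))"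
proof -
  have "bij_betw ((!) (sorted_list_of_set W)) {..<card W} W"
    using assms by (intro bij_betw_nth) auto
  then show ?thesis
    by (simp add: slot_def sum.reindex_bij_betw)
qed

section \<open>The affine model and its descent directions\<close>

lemma decision_set_eq_cbox:
  "decision_set Ebar Rmax fmax Ic t = cbox 0 (vector [Ebar, fmax t, Rmax * Ic t])"
  by (auto simp: decision_set_def mem_box_cart forall_3)

text \<open>Objective and constraints are affine, so the gradient terms are exact differences. The
  slot \<open>t\<close> on the right is free because \<open>D * fsen t\<close> cancels.\<close>

lemma inner_direction:
  "direction \<gamma> objective (constraint_fun D \<kappa> \<rho> fsen) W x \<tau> \<bullet> (u - v)
    = u $ 1 - v $ 1
      + ((\<chi> i. virtual_queue \<gamma> (constraint_fun D \<kappa> \<rho> fsen) W x i \<tau>)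
           + \<gamma> *\<^sub>R constraint_fun D \<kappa> \<rho> fsen (slot W \<tau>) (x (slot W \<tau>)))
        \<bullet> (\<gamma> *\<^sub>R constraint_fun D \<kappa> \<rho> fsen t u - \<gamma> *\<^sub>R constraint_fun D \<kappa> \<rho> fsen t v)"
  unfolding direction_def Let_def sum_2 gradient_objective gradient_constraint_1
    gradient_constraint_2
  by (simp add: inner_add_left inner_axis' inner_vec_def[where 'b=2] sum_2 constraint_fun_def)
    (simp add: algebra_simps)

lemma window_run_mem:
  assumes "window_run \<alpha> \<gamma> X f g W x" "finite W" "k < card W"
    and "\<And>t. t \<in> W \<Longrightarrow> closed (X t)" "\<And>t. t \<in> W \<Longrightarrow> X t \<noteq> {}"
  shows "x (slot W (Suc k)) \<in> X (slot W (Suc k))"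
proof (cases k)
  case 0
  then show ?thesis using assms by (auto simp: window_run_def)
next
  case (Suc m)
  then have "Suc k \<in> {2..card W}" using assms by auto
  then show ?thesis
    using assms closest_point_in_set[of "X (slot W (Suc k))"] slot_mem[of W k]
    unfolding window_run_def by metis
qed

lemma window_run_step:
  assumes "window_run \<alpha> \<gamma> X f g W x" "Suc k < card W"
  shows "x (slot W (Suc (Suc k))) = closest_point (X (slot W (Suc (Suc k))))
           (x (slot W (Suc k)) - (1 / (2 * \<alpha>)) *\<^sub>R direction \<gamma> f g W x (Suc k))"
proof -
  have "Suc (Suc k) \<in> {2..card W}" using assms by auto
  from bspec[OF conjunct2[OF assms(1)[unfolded window_run_def]] this] show ?thesis by simp
qed

section \<open>Objective within one window\<close>

lemma window_objective_bound:
  assumes run: "window_run \<alpha> \<gamma> (decision_set Ebar Rmax fmax Ic) objective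
                  (constraint_fun D \<kappa> \<rho> fsen) W x"
    and W: "finite W"
    and ne: "\<And>t. t \<in> W \<Longrightarrow> decision_set Ebar Rmax fmax Ic t \<noteq> {}"
    and "0 < \<alpha>" "0 \<le> Ebar"
  shows "(\<Sum>t\<in>W. objective t (x t)) \<le> Ebar + \<alpha> * Ebar\<^sup>2"
proof -
  define e where "e k = x (slot W (Suc k)) $ 1" for k
  have mem: "x (slot W (Suc k)) \<in> decision_set Ebar Rmax fmax Ic (slot W (Suc k))"
    if "k < card W" for k
    using window_run_mem[OF run W that] ne by (simp add: decision_set_eq_cbox closed_cbox)
  have step: "e (Suc k) \<le> \<alpha> * (e k)\<^sup>2 - \<alpha> * (e (Suc k))\<^sup>2" if "Suc k < card W" for k
  proof -
    define z where "z = x (slot W (Suc (Suc k)))"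
    define p where "p = x (slot W (Suc k))"
    \<comment> \<open>Testing against \<open>z\<close> with its first coordinate reset to \<open>0\<close> decouples that coordinate.\<close>
    define y :: "real^3" where "y = vector [0, z $ 2, z $ 3]"
    have "y \<in> decision_set Ebar Rmax fmax Ic (slot W (Suc (Suc k)))"
      using mem[OF that] \<open>0 \<le> Ebar\<close> by (auto simp: decision_set_def y_def z_def)
    then have "direction \<gamma> objective (constraint_fun D \<kappa> \<rho> fsen) W x (Suc k) \<bullet> (z - y)
        + 2 * \<alpha> * ((z - p) \<bullet> (z - y)) \<le> 0"
      using window_run_step[OF run that] \<open>0 < \<alpha>\<close> unfolding z_def p_def
      by (intro closest_point_step_variational)
        (auto simp: decision_set_eq_cbox convex_box closed_cbox)
    \<comment> \<open>\<open>y\<close> and \<open>z\<close> agree in the two coordinates that enter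
      the constraints, so the queue term vanishes; slot 0 merely fills in the free
      \<open>t\<close>.\<close>
    moreover have "direction \<gamma> objective (constraint_fun D \<kappa> \<rho> fsen) W x (Suc k) \<bullet> (z - y) = z $ 1"
    proof -
      have "constraint_fun D \<kappa> \<rho> fsen 0 z = constraint_fun D \<kappa> \<rho> fsen 0 y"
        by (simp add: constraint_fun_def y_def)
      then show ?thesis
        unfolding inner_direction[where t = 0] by (simp add: y_def)
    qed
    moreover have "(z - p) \<bullet> (z - y) = (z $ 1 - p $ 1) * z $ 1"
      by (simp add: inner_vec_def sum_3 y_def)
    ultimately have "z $ 1 + 2 * \<alpha> * ((z $ 1 - p $ 1) * z $ 1) \<le> 0"
      by simp
    \<comment> \<open>In the first coordinate
      \<open>2 * (z - p) * z = z\<^sup>2 - p\<^sup>2 + (z - p)\<^sup>2\<close>, and the last square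
      is dropped.\<close>
    moreover have "0 \<le> \<alpha> * (z $ 1 - p $ 1)\<^sup>2"
      using \<open>0 < \<alpha>\<close> by simp
    ultimately show ?thesis
      unfolding e_def z_def[symmetric] p_def[symmetric]
      by (simp add: power2_eq_square algebra_simps)
  qed
  have e_bounds: "0 \<le> e k \<and> e k \<le> Ebar" if "k < card W" for k
    using mem[OF that] by (simp add: decision_set_def e_def)
  \<comment> \<open>The first decision of a window is arbitrary and obeys no step inequality, so
    \<open>e 0\<close> stands outside the telescoping. The negative last term is kept for the
    induction.\<close>
  have tele: "(\<Sum>k<Suc m. e k) \<le> e 0 + \<alpha> * (e 0)\<^sup>2 - \<alpha> * (e m)\<^sup>2" if "m < card W" for m
    using that
  proof (induction m)
    case (Suc m)
    then show ?case using step[of m] by simp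
  qed simp
  show ?thesis
  proof (cases "card W")
    case 0
    then show ?thesis using assms by (simp add: W)
  next
    case (Suc m)
    have "(\<Sum>t\<in>W. objective t (x t)) = (\<Sum>k<Suc m. e k)"
      unfolding sum_slot[OF W] Suc e_def objective_def ..
    also have "\<dots> \<le> e 0 + \<alpha> * (e 0)\<^sup>2 - \<alpha> * (e m)\<^sup>2"
      using tele Suc by simp
    also have "\<dots> \<le> e 0 + \<alpha> * (e 0)\<^sup>2"
      using \<open>0 < \<alpha>\<close> by simp
    also have "\<dots> \<le> Ebar + \<alpha> * Ebar\<^sup>2"
      using e_bounds[of 0] Suc \<open>0 < \<alpha>\<close>
      by (intro add_mono mult_left_mono power_mono) auto
    finally show ?thesis .
  qed
qed

section \<open>Queue length under the Slater condition\<close>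

text \<open>One \<open>\<gamma> * G2\<close> in the bound pays for passing between the weights
  \<open>q + a\<close> and \<open>q\<close>, the other for the step that may cross the
  threshold.\<close>

lemma virtual_queue_norm_bound:
  fixes D \<kappa> \<rho> :: real and fsen :: "nat \<Rightarrow> real"
  defines "g \<equiv> constraint_fun D \<kappa> \<rho> fsen"
  assumes run: "window_run \<alpha> \<gamma> X objective g W x"
    and W: "finite W" "n < card W"
    and X: "\<And>t. t \<in> W \<Longrightarrow> convex (X t)" "\<And>t. t \<in> W \<Longrightarrow> closed (X t)"
    and G1: "\<And>t y z. t \<in> W \<Longrightarrow> y \<in> X t \<Longrightarrow> z \<in> X t \<Longrightarrow> norm (y - z) \<le> G1"
    and G2: "\<And>t y. t \<in> W \<Longrightarrow> y \<in> X t \<Longrightarrow> norm (g t y) \<le> G2"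
    and xhat: "\<And>t. t \<in> W \<Longrightarrow> xhat \<in> X t" "\<And>t i. t \<in> W \<Longrightarrow> g t xhat $ i \<le> - \<epsilon>"
    and pos: "0 < \<alpha>" "0 < \<gamma>" "0 < \<epsilon>"
  shows "norm (\<chi> i. virtual_queue \<gamma> g W x i (Suc n))
    \<le> 2 * \<gamma> * G2 + (\<alpha> * G1\<^sup>2 + G1 + 2 * \<gamma>\<^sup>2 * G2\<^sup>2) / (\<gamma> * \<epsilon>)"
proof -
  \<comment> \<open>Slots are indexed from 0: \<open>q k\<close> is the queue before slot
    \<open>s k\<close>, and \<open>q (Suc k)\<close> the one after it.\<close>
  define s where "s k = slot W (Suc k)" for k
  define q where "q k = (\<chi> i. virtual_queue \<gamma> g W x i k)" for k
  define a where "a k = \<gamma> *\<^sub>R g (s k) (x (s k))" for k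
  \<comment> \<open>Chosen so that \<open>\<gamma> * \<epsilon> * \<Theta>\<close> covers three
    errors: the proximal term, the objective, and the exchange of \<open>a k\<close> for
    \<open>a (Suc k)\<close>.\<close>
  define \<Theta> where "\<Theta> = (\<alpha> * G1\<^sup>2 + G1 + 2 * \<gamma>\<^sup>2 * G2\<^sup>2) / (\<gamma> * \<epsilon>)"
  have sW: "s k \<in> W" if "k < card W" for k
    using slot_mem[OF W(1) that] by (simp add: s_def)
  have mem: "x (s k) \<in> X (s k)" if "k < card W" for k
    using window_run_mem[OF run W(1) that] X xhat unfolding s_def by blast
  have a_le: "norm (a k) \<le> \<gamma> * G2" if "k < card W" for k
    using G2[OF sW[OF that] mem[OF that]] \<open>0 < \<gamma>\<close> by (simp add: a_def)
  have q_Suc: "q (Suc k) $ i = max (- a k $ i) (q k $ i + a k $ i)" for k i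
    by (simp add: q_def a_def s_def Let_def)
  have q_nonneg: "0 \<le> q k $ i" for k i
    by (simp add: q_def virtual_queue_nonneg)
  have q_growth: "norm (q (Suc k)) \<le> norm (q k) + \<gamma> * G2" if "k < card W" for k
    using queue_norm_growth[of "q (Suc k)" "a k" "q k"] q_Suc q_nonneg a_le[OF that] by force
  have "0 < card W" using W by simp
  have "0 \<le> G1" using order_trans[OF norm_ge_zero G1[OF sW mem mem]] \<open>0 < card W\<close> by blast
  have "0 \<le> G2" using order_trans[OF norm_ge_zero G2[OF sW mem]] \<open>0 < card W\<close> by blast
  have "0 \<le> \<Theta>" using \<open>0 \<le> G1\<close> pos by (simp add: \<Theta>_def)
  have decrease: "norm (q (Suc (Suc k))) \<le> norm (q (Suc k))"
    if k: "Suc k < card W" and large: "\<Theta> + \<gamma> * G2 \<le> norm (q (Suc k))" for k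
  proof -
    let ?p = "x (s k)" and ?z = "x (s (Suc k))" and ?b = "q (Suc k) + a k"
    let ?ghat = "\<gamma> *\<^sub>R g (s (Suc k)) xhat"
    note t = sW[OF k] mem[OF k]
    have k': "k < card W" using k by simp
    have "direction \<gamma> objective g W x (Suc k) \<bullet> (?z - xhat)
        + 2 * \<alpha> * ((?z - ?p) \<bullet> (?z - xhat)) \<le> 0"
      using window_run_step[OF run k] t X xhat pos unfolding s_def
      by (intro closest_point_step_variational) auto
    \<comment> \<open>Taking \<open>s (Suc k)\<close> as the free slot brings in
      \<open>a (Suc k)\<close>, the value that drives the next queue update.\<close>
    then have "?z $ 1 - xhat $ 1 + ?b \<bullet> (a (Suc k) - ?ghat)
        + \<alpha> * (2 * ((?z - ?p) \<bullet> (?z - xhat))) \<le> 0"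
      unfolding g_def inner_direction[where t = "s (Suc k)"]
      by (simp add: q_def a_def s_def g_def mult.assoc mult.left_commute)
    moreover have "- G1 \<le> ?z $ 1 - xhat $ 1"
      using component_le_norm_cart[of "?z - xhat" 1] G1[OF t(1) t(2) xhat(1)[OF t(1)]] by simp
    moreover have "- (\<alpha> * G1\<^sup>2) \<le> \<alpha> * (2 * ((?z - ?p) \<bullet> (?z - xhat)))"
    proof -
      have 1: "2 * ((?z - ?p) \<bullet> (?z - xhat)) = (norm (xhat - ?z))\<^sup>2 + (norm (?z - ?p))\<^sup>2 - (norm (xhat - ?p))\<^sup>2"
        by (rule inner_three_point)
      \<comment> \<open>\<open>?p\<close> was chosen in the preceding slot, so the diameter bound is
        taken in \<open>X (s k)\<close>, which also contains \<open>xhat\<close>.\<close>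
      have "norm (xhat - ?p) \<le> G1"
        using G1[OF sW[OF k'] xhat(1)[OF sW[OF k']] mem[OF k']] .
      then have "(norm (xhat - ?p))\<^sup>2 \<le> G1\<^sup>2" by (intro power_mono) auto
      then have "- (G1\<^sup>2) \<le> 2 * ((?z - ?p) \<bullet> (?z - xhat))"
        unfolding 1 using zero_le_power2[of "norm (xhat - ?z)"] zero_le_power2[of "norm (?z - ?p)"]
        by linarith
      then have "\<alpha> * - (G1\<^sup>2) \<le> \<alpha> * (2 * ((?z - ?p) \<bullet> (?z - xhat)))"
        using pos by (intro mult_left_mono) auto
      then show ?thesis by simp
    qed
    \<comment> \<open>Each nonnegative weight meets a slack of at least
      \<open>\<gamma> * \<epsilon>\<close>, and the sum of the weights dominates their Euclidean
      norm, which is at least \<open>\<Theta>\<close>.\<close>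
    moreover have "\<gamma> * \<epsilon> * \<Theta> \<le> - (?b \<bullet> ?ghat)"
    proof -
      have b_nonneg: "0 \<le> ?b $ i" for i
        using virtual_queue_plus_nonneg[of \<gamma> g W x i k] by (simp add: q_def a_def s_def)
      have "norm (q (Suc k)) \<le> norm ?b + norm (a k)"
        using norm_triangle_ineq4[of ?b "a k"] by simp
      then have "\<Theta> \<le> norm ?b" using large a_le[OF k'] by simp
      also have "\<dots> \<le> (\<Sum>i\<in>UNIV. \<bar>?b $ i\<bar>)" by (rule norm_le_l1_cart)
      also have "\<dots> = (\<Sum>i\<in>UNIV. ?b $ i)" using b_nonneg by (intro sum.cong) auto
      finally have "\<gamma> * \<epsilon> * \<Theta> \<le> \<gamma> * \<epsilon> * (\<Sum>i\<in>UNIV. ?b $ i)"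
        using pos by (intro mult_left_mono) auto
      also have "\<dots> = (\<Sum>i\<in>UNIV. ?b $ i * (\<gamma> * \<epsilon>))"
        by (simp add: sum_distrib_left mult.commute)
      also have "\<dots> \<le> (\<Sum>i\<in>UNIV. ?b $ i * - (?ghat $ i))"
      proof (intro sum_mono mult_left_mono b_nonneg)
        fix i
        have "\<gamma> * \<epsilon> \<le> \<gamma> * - (g (s (Suc k)) xhat $ i)"
          using xhat(2)[OF t(1), of i] pos by (intro mult_left_mono) auto
        then show "\<gamma> * \<epsilon> \<le> - (?ghat $ i)" by simp
      qed
      also have "\<dots> = - (?b \<bullet> ?ghat)" by (simp add: inner_vec_def sum_negf)
      finally show ?thesis .
    qed
    moreover have "\<gamma> * \<epsilon> * \<Theta> = \<alpha> * G1\<^sup>2 + G1 + 2 * \<gamma>\<^sup>2 * G2\<^sup>2"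
      using pos by (simp add: \<Theta>_def)
    \<comment> \<open>The facts so far control \<open>(q (Suc k) + a k) \<bullet> a (Suc k)\<close>,
      whereas the drift needs
      \<open>q (Suc k) \<bullet> a (Suc k) + (norm (a (Suc k)))\<^sup>2\<close>; this is the
      difference.\<close>
    moreover have "(norm (a (Suc k)))\<^sup>2 - a k \<bullet> a (Suc k) \<le> 2 * \<gamma>\<^sup>2 * G2\<^sup>2"
    proof -
      have "(norm (a (Suc k)))\<^sup>2 - a k \<bullet> a (Suc k) = (a (Suc k) - a k) \<bullet> a (Suc k)"
        by (simp add: power2_norm_eq_inner inner_diff_left)
      also have "\<dots> \<le> norm (a (Suc k) - a k) * norm (a (Suc k))" by (rule norm_cauchy_schwarz)
      also have "\<dots> \<le> (2 * (\<gamma> * G2)) * (\<gamma> * G2)"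
        using norm_triangle_ineq4[of "a (Suc k)" "a k"] a_le[OF k] a_le[OF k'] \<open>0 \<le> G2\<close> pos
        by (intro mult_mono) auto
      also have "\<dots> = 2 * \<gamma>\<^sup>2 * G2\<^sup>2" by (simp add: power2_eq_square)
      finally show ?thesis .
    qed
    ultimately have "q (Suc k) \<bullet> a (Suc k) + (norm (a (Suc k)))\<^sup>2 \<le> 0"
      by (simp add: inner_add_left inner_diff_right)
    then have "(norm (q (Suc (Suc k))))\<^sup>2 \<le> (norm (q (Suc k)))\<^sup>2"
      using queue_drift[OF q_Suc, of "Suc k"] by linarith
    then show ?thesis by (rule power2_le_imp_le) simp
  qed
  have "norm (q (Suc m)) \<le> 2 * \<gamma> * G2 + \<Theta>" if "m < card W" for m
    using that
  proof (induction m)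
    case 0
    have "q 0 = 0" by (simp add: q_def vec_eq_iff)
    moreover have "0 \<le> \<gamma> * G2" using \<open>0 \<le> G2\<close> pos by simp
    ultimately show ?case using q_growth[OF 0] \<open>0 \<le> \<Theta>\<close> by simp
  next
    case (Suc m)
    show ?case
    proof (cases "\<Theta> + \<gamma> * G2 \<le> norm (q (Suc m))")
      case True
      then show ?thesis using decrease[OF Suc.prems] Suc by simp
    next
      case False
      then show ?thesis using q_growth[OF Suc.prems] by simp
    qed
  qed
  from this[OF W(2)] show ?thesis by (simp add: q_def \<Theta>_def)
qed

section \<open>Summing over the windows\<close>

theorem theorem1:
  fixes Ebar Rmax D \<kappa> \<rho> G1 G2 \<beta> \<epsilon> :: real
    and L K :: nat and \<Omega> :: "nat \<Rightarrow> (real^'n) set"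
    and fmax Ic fsen :: "nat \<Rightarrow> nat \<Rightarrow> real" and c :: "nat \<Rightarrow> nat \<Rightarrow> real^'n"
    and X :: "nat \<Rightarrow> nat \<Rightarrow> (real^3) set"
    and f :: "nat \<Rightarrow> real^3 \<Rightarrow> real"
    and g :: "nat \<Rightarrow> nat \<Rightarrow> real^3 \<Rightarrow> real^2"
    and W :: "nat \<Rightarrow> nat \<Rightarrow> nat set"
    and x xstar :: "nat \<Rightarrow> nat \<Rightarrow> real^3"
  assumes X: "X = (\<lambda>T. decision_set Ebar Rmax (fmax T) (Ic T))"
    and f: "f = objective"
    and g: "g = (\<lambda>T. constraint_fun D \<kappa> \<rho> (fsen T))"
    and W: "W = (\<lambda>T k. window T (c T) (\<Omega> k))"
    and rho: "0 \<le> \<rho>" "\<rho> \<le> 1"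
    and fsen: "\<And>T t. t \<in> {1..T} \<Longrightarrow> 0 \<le> fsen T t"
    and Ic: "\<And>T t. t \<in> {1..T} \<Longrightarrow> Ic T t \<in> {0, 1}"
    and partition: "hypercube_partition L \<Omega>" "K = L ^ CARD('n)"
    and pattern: "\<And>T t j. t \<in> {1..T} \<Longrightarrow> 0 \<le> c T t $ j \<and> c T t $ j \<le> 1"
    and G1: "\<And>T t y z. t \<in> {1..T} \<Longrightarrow> y \<in> X T t \<Longrightarrow> z \<in> X T t \<Longrightarrow> norm (y - z) \<le> G1"
    and G2: "\<And>T t y. t \<in> {1..T} \<Longrightarrow> y \<in> X T t \<Longrightarrow> norm (g T t y) \<le> G2"
    and beta: "\<And>T t y z. t \<in> {1..T} \<Longrightarrow> y \<in> X T t \<Longrightarrow> z \<in> X T t \<Longrightarrow>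
                 norm (g T t y - g T t z) \<le> \<beta> * norm (y - z)"
    and slater: "0 < \<epsilon>"
      "\<And>T. \<exists>xhat. \<forall>t\<in>{1..T}. xhat \<in> X T t \<and> (\<forall>i. g T t xhat $ i \<le> - \<epsilon>)"
    and run: "\<And>T k. 1 \<le> T \<Longrightarrow> k \<in> {1..K} \<Longrightarrow>
                window_run (1/2 * (\<beta>\<^sup>2 + 1) * sqrt (real T)) (real T powr (1/4))
                  (X T) f (g T) (W T k) (x T)"
    and xstar: "\<And>T k. 1 \<le> T \<Longrightarrow> k \<in> {1..K} \<Longrightarrow>
                is_arg_min (\<lambda>y. \<Sum>t\<in>W T k. f t y) (\<lambda>y. \<forall>t\<in>W T k. y \<in> X T t) (xstar T k)"
  shows "(\<exists>C. \<forall>T\<ge>1. (\<Sum>k=1..K. \<Sum>t\<in>W T k. f t (x T t))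
                   \<le> (\<Sum>k=1..K. \<Sum>t\<in>W T k. f t (xstar T k)) + C * sqrt (real T)) \<and>
         (\<forall>T\<ge>1. \<forall>i. (\<Sum>k=1..K. \<Sum>t\<in>W T k. g T t (x T t) $ i)
                   \<le> 2 * real K * G2
                     + real K * (1/2 * (\<beta>\<^sup>2 + 1) * G1\<^sup>2 + G1 + 2 * G2\<^sup>2) / \<epsilon>
                     + real K * G1 / (\<epsilon> * sqrt (real T)))"
proof -
  define \<alpha> where "\<alpha> T = 1/2 * (\<beta>\<^sup>2 + 1) * sqrt (real T)" for T
  define \<gamma> where "\<gamma> T = real T powr (1/4)" for T
  have \<alpha>_pos: "0 < \<alpha> T" and \<gamma>_pos: "0 < \<gamma> T" and \<gamma>_sq: "\<gamma> T * \<gamma> T = sqrt (real T)"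
    if "1 \<le> T" for T
  proof -
    have "0 < \<beta>\<^sup>2 + 1" by (simp add: add_nonneg_pos)
    then show "0 < \<alpha> T" using that by (simp add: \<alpha>_def)
    show "0 < \<gamma> T" using that by (simp add: \<gamma>_def)
    show "\<gamma> T * \<gamma> T = sqrt (real T)"
      using that by (simp add: \<gamma>_def powr_add[symmetric] powr_half_sqrt)
  qed
  have run': "window_run (\<alpha> T) (\<gamma> T) (decision_set Ebar Rmax (fmax T) (Ic T)) objective
      (constraint_fun D \<kappa> \<rho> (fsen T)) (W T k) (x T)" if "1 \<le> T" "k \<in> {1..K}" for T k
    using run[OF that] by (simp add: X f g \<alpha>_def \<gamma>_def)
  have W_sub: "W T k \<subseteq> {1..T}" for T k by (auto simp: W window_def)
  then have fin: "finite (W T k)" for T k by (rule finite_subset) simp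
  \<comment> \<open>The Slater point for horizon 1 gives the signs of \<open>Ebar\<close>,
    \<open>G1\<close> and \<open>G2\<close>, which are independent of the horizon.\<close>
  obtain x1 where "x1 \<in> X 1 1" using slater(2)[of 1] by auto
  then have "0 \<le> Ebar" by (auto simp: X decision_set_def)
  have "0 \<le> G1" using G1[of 1 1 x1 x1] \<open>x1 \<in> X 1 1\<close> by simp
  have "0 \<le> G2" using order_trans[OF norm_ge_zero G2[of 1 1 x1]] \<open>x1 \<in> X 1 1\<close> by simp
  \<comment> \<open>Sum of \<open>K\<close> window bounds: \<open>\<alpha> T\<close> carries the
    factor \<open>sqrt (real T)\<close>, and \<open>Ebar\<close> is enlarged by it.\<close>
  define C where "C = real K * (Ebar + 1/2 * (\<beta>\<^sup>2 + 1) * Ebar\<^sup>2)"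
  have "(\<Sum>k=1..K. \<Sum>t\<in>W T k. f t (x T t))
      \<le> (\<Sum>k=1..K. \<Sum>t\<in>W T k. f t (xstar T k)) + C * sqrt (real T)" if T: "1 \<le> T" for T
  proof -
    have "(\<Sum>t\<in>W T k. f t (x T t)) \<le> Ebar + \<alpha> T * Ebar\<^sup>2" if "k \<in> {1..K}" for k
      unfolding f
    proof (rule window_objective_bound[OF run'[OF T that] fin _ \<alpha>_pos[OF T] \<open>0 \<le> Ebar\<close>])
      fix t assume "t \<in> W T k"
      then show "decision_set Ebar Rmax (fmax T) (Ic T) t \<noteq> {}"
        using slater(2)[of T] W_sub[of T k] unfolding X by blast
    qed
    then have "(\<Sum>k=1..K. \<Sum>t\<in>W T k. f t (x T t)) \<le> (\<Sum>k=1..K. Ebar + \<alpha> T * Ebar\<^sup>2)"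
      by (rule sum_mono)
    also have "\<dots> = real K * (Ebar + \<alpha> T * Ebar\<^sup>2)" by simp
    also have "\<dots> \<le> real K * (Ebar * sqrt (real T) + \<alpha> T * Ebar\<^sup>2)"
      using T mult_left_mono[of 1 "sqrt (real T)" Ebar] \<open>0 \<le> Ebar\<close> less_imp_le[OF \<alpha>_pos[OF T]]
      by (intro mult_left_mono add_mono) auto
    also have "\<dots> = C * sqrt (real T)" by (simp add: C_def \<alpha>_def algebra_simps)
    finally have "(\<Sum>k=1..K. \<Sum>t\<in>W T k. f t (x T t)) \<le> C * sqrt (real T)" .
    \<comment> \<open>The comparator spends nonnegative energy, so bounding the algorithm's own cost
      suffices.\<close>
    moreover have "0 \<le> (\<Sum>k=1..K. \<Sum>t\<in>W T k. f t (xstar T k))"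
    proof (intro sum_nonneg)
      fix k t assume "k \<in> {1..K}" "t \<in> W T k"
      then have "xstar T k \<in> X T t" using xstar[OF T] by (auto simp: is_arg_min_def)
      then show "0 \<le> f t (xstar T k)" by (simp add: X f decision_set_def objective_def)
    qed
    ultimately show ?thesis by simp
  qed
  moreover have "(\<Sum>k=1..K. \<Sum>t\<in>W T k. g T t (x T t) $ i)
      \<le> 2 * real K * G2 + real K * (1/2 * (\<beta>\<^sup>2 + 1) * G1\<^sup>2 + G1 + 2 * G2\<^sup>2) / \<epsilon>
        + real K * G1 / (\<epsilon> * sqrt (real T))" if T: "1 \<le> T" for T i
  proof -
    define B where "B = 2 * G2 + (1/2 * (\<beta>\<^sup>2 + 1) * G1\<^sup>2 + G1 + 2 * G2\<^sup>2) / \<epsilon>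
        + G1 / (\<epsilon> * sqrt (real T))"
    obtain xhat where xhat: "\<And>t. t \<in> {1..T} \<Longrightarrow> xhat \<in> X T t"
        "\<And>t i. t \<in> {1..T} \<Longrightarrow> g T t xhat $ i \<le> - \<epsilon>"
      using slater(2)[of T] by blast
    have "(\<Sum>t\<in>W T k. g T t (x T t) $ i) \<le> B" if k: "k \<in> {1..K}" for k
    proof (cases "card (W T k)")
      case 0
      \<comment> \<open>An empty window has no last queue to compare with; its violation is
        0.\<close>
      have "0 \<le> B" using \<open>0 \<le> G1\<close> \<open>0 \<le> G2\<close> slater(1) by (simp add: B_def)
      then show ?thesis using 0 fin by simp
    next
      case (Suc n)
      let ?Q = "\<chi> i. virtual_queue (\<gamma> T) (g T) (W T k) (x T) i (Suc n)"
      note pos = \<alpha>_pos[OF T] \<gamma>_pos[OF T] slater(1)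
      have "\<gamma> T * (\<Sum>t\<in>W T k. g T t (x T t) $ i) \<le> ?Q $ i"
        using sum_le_virtual_queue[of "\<gamma> T" "g T" "W T k" "x T" i "Suc n"]
        unfolding sum_slot[OF fin] Suc sum_distrib_left by simp
      also have "\<dots> \<le> norm ?Q" using component_le_norm_cart[of ?Q i] by simp
      also have "\<dots> \<le> 2 * \<gamma> T * G2
          + (\<alpha> T * G1\<^sup>2 + G1 + 2 * (\<gamma> T)\<^sup>2 * G2\<^sup>2) / (\<gamma> T * \<epsilon>)"
        unfolding g
      proof (rule virtual_queue_norm_bound[where xhat = xhat, OF run'[OF T k] fin])
        show "n < card (W T k)" using Suc by simp
      qed (use G1[of _ T] G2[of _ T] xhat W_sub[of T k] pos in
          \<open>auto simp: X g decision_set_eq_cbox subset_iff\<close>)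
      also have "\<dots> = \<gamma> T * (2 * G2
          + (\<alpha> T * G1\<^sup>2 + G1 + 2 * (\<gamma> T * \<gamma> T) * G2\<^sup>2) / (\<gamma> T * \<gamma> T * \<epsilon>))"
        using pos by (simp add: field_simps power2_eq_square)
      finally have "(\<Sum>t\<in>W T k. g T t (x T t) $ i) \<le> 2 * G2
          + (\<alpha> T * G1\<^sup>2 + G1 + 2 * (\<gamma> T * \<gamma> T) * G2\<^sup>2) / (\<gamma> T * \<gamma> T * \<epsilon>)"
        using pos by (simp only: mult_le_cancel_left_pos)
      \<comment> \<open>As \<open>\<gamma> T * \<gamma> T = sqrt (real T)\<close>, the quotient of
        \<open>\<alpha> T\<close> by it is constant, and only \<open>G1\<close> keeps a factor
        \<open>1 / sqrt (real T)\<close>.\<close>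
      also have "\<dots> = 2 * G2 + (1/2 * (\<beta>\<^sup>2 + 1) * G1\<^sup>2 + 2 * G2\<^sup>2) / \<epsilon> + G1 / (\<epsilon> * sqrt (real T))"
        unfolding \<gamma>_sq[OF T] \<alpha>_def using T slater(1) by (simp add: field_simps)
      \<comment> \<open>\<open>B\<close> is larger by \<open>G1 / \<epsilon>\<close>.\<close>
      also have "\<dots> \<le> B"
        using \<open>0 \<le> G1\<close> slater(1) by (simp add: B_def add_divide_distrib)
      finally show ?thesis .
    qed
    then have "(\<Sum>k=1..K. \<Sum>t\<in>W T k. g T t (x T t) $ i) \<le> (\<Sum>k=1..K. B)"
      by (rule sum_mono)
    also have "\<dots> = real K * B" by simp
    finally show ?thesis by (simp add: B_def distrib_left mult.assoc)
  qed
  ultimately show ?thesis by blast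
qed

end
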